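(* Let $(W,S)$ be a Coxeter system with $S$ finite, and let $T$ be a cone type of $W$. Then $$T=\bigcap_{\beta\in\partial T}H_\beta^+.$$ Moreover, removing any root from this intersection results in strict containment: for every $\beta_0\in\partial T$, $T\subsetneq\bigcap_{\beta\in\partial T\setminus\{\beta_0\}}H_\beta^+$.
   Context: $\ell$ is the length function. The cone type of $x\in W$ is $T(x)=\{y\in W\mid\ell(xy)=\ell(x)+\ell(y)\}$; a cone type is a set of this form. Root system: $V$ is the real vector space with basis $\{\alpha_s\mid s\in S\}$ and symmetric bilinear form $\langle\alpha_s,\alpha_t\rangle=-\cos(\pi/m_{s,t})$, with $m_{s,t}$ the order of $st$ (value $-1$ if $m_{s,t}=\infty$); $W$ acts by $s\lambda=\lambda-2\langle\lambda,\alpha_s\rangle\alpha_s$; $\Phi=\{w\alpha_s\mid w\in W,s\in S\}$; $\Phi^+$ is the set of roots that are non-negative combinations of the $\alpha_s$, and $\alpha<0$ means $-\alpha\in\Phi^+$. For $\beta=w\alpha_s$, $s_\beta=wsw^{-1}$. The inversion set is $\Phi(w)=\{\alpha\in\Phi^+\mid w^{-1}\alpha<0\}$, and for $\beta\in\Phi^+$, $H_\beta^+=\{w\in W\mid\ell(s_\beta w)>\ell(w)\}$. Boundary roots: if $x\in W$ is such that $T=T(x^{-1})$, then $\partial T=\{\beta\in\Phi^+\mid\text{there exists }w\in W\text{ with }\Phi(x)\cap\Phi(w)=\{\beta\}\}$; this does not depend on the choice of $x$ with $T(x^{-1})=T$. An intersection over an empty index set is $W$. *)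

theory Defs
  imports "HOL-Analysis.Analysis" "HOL-Algebra.Algebra"
begin

section \<open>Group presentations\<close>

text \<open>A word of the free group on a set is a list of signed letters: the letter \<open>(s, True)\<close>
  stands for \<open>s\<close> and \<open>(s, False)\<close> for its formal inverse.\<close>

definition signed_words :: "'a set \<Rightarrow> ('a \<times> bool) list set" where
  "signed_words S = lists (S \<times> UNIV)"

definition word_value :: "('a, 'b) monoid_scheme \<Rightarrow> ('a \<times> bool) list \<Rightarrow> 'a" where
  "word_value G w =
     foldr (\<lambda>(s, b) x. (if b then s else inv\<^bsub>G\<^esub> s) \<otimes>\<^bsub>G\<^esub> x) w \<one>\<^bsub>G\<^esub>"

text \<open>Equality in the group with generators \<open>S\<close> and relators \<open>R\<close>. No step changes whether all
  letters of a word lie in \<open>S\<close> (when \<open>R\<close> consists of words over \<open>S\<close>), so no side condition on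
  \<open>u\<close> and \<open>v\<close> is needed.\<close>

inductive pres_equiv ::
  "'a set \<Rightarrow> ('a \<times> bool) list set \<Rightarrow> ('a \<times> bool) list \<Rightarrow> ('a \<times> bool) list \<Rightarrow> bool"
  for S R where
  refl: "pres_equiv S R w w"
| sym: "pres_equiv S R w w' \<Longrightarrow> pres_equiv S R w' w"
| trans: "pres_equiv S R w w' \<Longrightarrow> pres_equiv S R w' w'' \<Longrightarrow> pres_equiv S R w w''"
| cancel: "s \<in> S \<Longrightarrow> pres_equiv S R (u @ [(s, b), (s, \<not> b)] @ v) (u @ v)"
| relator: "r \<in> R \<Longrightarrow> pres_equiv S R (u @ r @ v) (u @ v)"

definition has_presentation ::
  "('a, 'b) monoid_scheme \<Rightarrow> 'a set \<Rightarrow> ('a \<times> bool) list set \<Rightarrow> bool" where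
  "has_presentation G S R \<longleftrightarrow>
     S \<subseteq> carrier G \<and> generate G S = carrier G \<and>
     (\<forall>w \<in> signed_words S. word_value G w = \<one>\<^bsub>G\<^esub> \<longleftrightarrow> pres_equiv S R w [])"

section \<open>Coxeter systems, length and cone types\<close>

text \<open>\<open>group.ord\<close> is \<open>0\<close> on elements of infinite order, so the value \<open>0\<close> encodes
  \<open>m s t = \<infinity>\<close>.\<close>

definition cox_m :: "('a, 'b) monoid_scheme \<Rightarrow> 'a \<Rightarrow> 'a \<Rightarrow> nat" where
  "cox_m W s t = group.ord W (s \<otimes>\<^bsub>W\<^esub> t)"

definition coxeter_relators ::
  "('a, 'b) monoid_scheme \<Rightarrow> 'a set \<Rightarrow> ('a \<times> bool) list set" where
  "coxeter_relators W S =
     {concat (replicate (cox_m W s t) [(s, True), (t, True)]) | s t.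
        s \<in> S \<and> t \<in> S \<and> cox_m W s t \<noteq> 0}"

text \<open>Bourbaki's definition. The relators with \<open>s = t\<close> are the words \<open>s s\<close>, because then
  \<open>cox_m W s t = 1\<close>.\<close>

definition coxeter_system :: "('a, 'b) monoid_scheme \<Rightarrow> 'a set \<Rightarrow> bool" where
  "coxeter_system W S \<longleftrightarrow>
     group W \<and> S \<subseteq> carrier W \<and> (\<forall>s \<in> S. group.ord W s = 2) \<and>
     has_presentation W S (coxeter_relators W S)"

text \<open>The generators are involutions, so words in \<open>S\<close> without inverses suffice.\<close>

definition cox_length :: "('a, 'b) monoid_scheme \<Rightarrow> 'a set \<Rightarrow> 'a \<Rightarrow> nat" where
  "cox_length W S w =
     (LEAST n. \<exists>ss \<in> lists S. length ss = n \<and> foldr (mult W) ss \<one>\<^bsub>W\<^esub> = w)"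

definition cone_type :: "('a, 'b) monoid_scheme \<Rightarrow> 'a set \<Rightarrow> 'a \<Rightarrow> 'a set" where
  "cone_type W S x =
     {y \<in> carrier W. cox_length W S (x \<otimes>\<^bsub>W\<^esub> y) = cox_length W S x + cox_length W S y}"

definition is_cone_type :: "('a, 'b) monoid_scheme \<Rightarrow> 'a set \<Rightarrow> 'a set \<Rightarrow> bool" where
  "is_cone_type W S T \<longleftrightarrow> (\<exists>x \<in> carrier W. T = cone_type W S x)"

section \<open>The root system\<close>

text \<open>For finite \<open>S\<close>, the space with basis \<open>S\<close> is represented by the functions vanishing
  outside \<open>S\<close>, that is, by coordinate vectors with respect to the simple roots.\<close>

definition root_space :: "'a set \<Rightarrow> ('a \<Rightarrow> real) set" where
  "root_space S = {v. \<forall>s. s \<notin> S \<longrightarrow> v s = 0}"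

definition simple_root :: "'a \<Rightarrow> 'a \<Rightarrow> real" where
  "simple_root s = (\<lambda>t. if t = s then 1 else 0)"

definition gram :: "('a, 'b) monoid_scheme \<Rightarrow> 'a \<Rightarrow> 'a \<Rightarrow> real" where
  "gram W s t = (if cox_m W s t = 0 then - 1 else - cos (pi / real (cox_m W s t)))"

definition root_form ::
  "('a, 'b) monoid_scheme \<Rightarrow> 'a set \<Rightarrow> ('a \<Rightarrow> real) \<Rightarrow> ('a \<Rightarrow> real) \<Rightarrow> real" where
  "root_form W S u v = (\<Sum>s\<in>S. \<Sum>t\<in>S. u s * v t * gram W s t)"

definition reflect ::
  "('a, 'b) monoid_scheme \<Rightarrow> 'a set \<Rightarrow> 'a \<Rightarrow> ('a \<Rightarrow> real) \<Rightarrow> ('a \<Rightarrow> real)" where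
  "reflect W S s v = (\<lambda>t. v t - 2 * root_form W S v (simple_root s) * simple_root s t)"

text \<open>The action of \<open>W\<close> on the root space extending that of the generators. As \<open>S\<close> generates
  \<open>W\<close>, its values on \<open>carrier W\<close> are determined by these conditions.\<close>

definition cox_act ::
  "('a, 'b) monoid_scheme \<Rightarrow> 'a set \<Rightarrow> 'a \<Rightarrow> ('a \<Rightarrow> real) \<Rightarrow> ('a \<Rightarrow> real)" where
  "cox_act W S =
     (SOME \<rho>. group_action W (root_space S) \<rho> \<and>
        (\<forall>s \<in> S. \<forall>v \<in> root_space S. \<rho> s v = reflect W S s v))"

definition roots :: "('a, 'b) monoid_scheme \<Rightarrow> 'a set \<Rightarrow> ('a \<Rightarrow> real) set" where
  "roots W S = {cox_act W S w (simple_root s) | w s. w \<in> carrier W \<and> s \<in> S}"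

definition pos_roots :: "('a, 'b) monoid_scheme \<Rightarrow> 'a set \<Rightarrow> ('a \<Rightarrow> real) set" where
  "pos_roots W S = {\<beta> \<in> roots W S. \<forall>s \<in> S. 0 \<le> \<beta> s}"

definition root_reflection ::
  "('a, 'b) monoid_scheme \<Rightarrow> 'a set \<Rightarrow> ('a \<Rightarrow> real) \<Rightarrow> 'a" where
  "root_reflection W S \<beta> =
     (THE r. \<exists>w \<in> carrier W. \<exists>s \<in> S.
        \<beta> = cox_act W S w (simple_root s) \<and> r = w \<otimes>\<^bsub>W\<^esub> s \<otimes>\<^bsub>W\<^esub> inv\<^bsub>W\<^esub> w)"

definition inversion_set ::
  "('a, 'b) monoid_scheme \<Rightarrow> 'a set \<Rightarrow> 'a \<Rightarrow> ('a \<Rightarrow> real) set" where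
  "inversion_set W S w =
     {\<alpha> \<in> pos_roots W S. (\<lambda>t. - cox_act W S (inv\<^bsub>W\<^esub> w) \<alpha> t) \<in> pos_roots W S}"

definition pos_halfspace ::
  "('a, 'b) monoid_scheme \<Rightarrow> 'a set \<Rightarrow> ('a \<Rightarrow> real) \<Rightarrow> 'a set" where
  "pos_halfspace W S \<beta> =
     {w \<in> carrier W. cox_length W S (root_reflection W S \<beta> \<otimes>\<^bsub>W\<^esub> w) > cox_length W S w}"

section \<open>Boundary roots\<close>

text \<open>The description operator expresses that the set obtained from \<open>x\<close> is the same for all
  \<open>x\<close> with \<open>T = cone_type W S (inv x)\<close>.\<close>

definition boundary_roots ::
  "('a, 'b) monoid_scheme \<Rightarrow> 'a set \<Rightarrow> 'a set \<Rightarrow> ('a \<Rightarrow> real) set" where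
  "boundary_roots W S T =
     (THE B. \<forall>x \<in> carrier W. T = cone_type W S (inv\<^bsub>W\<^esub> x) \<longrightarrow>
        B = {\<beta> \<in> pos_roots W S.
               \<exists>w \<in> carrier W. inversion_set W S x \<inter> inversion_set W S w = {\<beta>}})"

end

(* A reduced word for y builds its inversion set one root at a time, and the cone type of the
   inverse of x consists of the y whose inversion set is disjoint from that of x. If it is not
   disjoint, the first prefix of y whose inversion set meets that of x meets it in a single root,
   which is therefore a boundary root and an inversion of y. So avoiding the boundary roots
   already forces y into the cone type. Conversely an element w witnessing that beta is a boundary
   root lies outside the cone type but violates no other half-space of the intersection. The
   correspondence of lengths and roots rests on Tits' theorem that an ascent s of w gives a
   nonnegative root w alpha_s. *)

theory Submission
  imports Defs
begin

section \<open>Alternating words and Chebyshev coefficients\<close>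

text \<open>The action of W, the reflection of a root and the set of boundary roots are given by
  choice or description, so each becomes usable only after a witness or its independence of choices
  is established. For the action this means that the reflections satisfy the defining relations. In
  the plane of two simple roots the coefficients produced by an alternating word are Chebyshev
  values, sin (k pi/m) / sin (pi/m) when m is finite: periodicity of the sine gives the relations,
  and its sign up to k = m gives the positivity behind Tits' theorem. The braid relation is what
  keeps an ascent inside this range. The link between cone types and inversion sets is a count: the
  length of the product of the inverse of x with y falls short of the sum of the lengths by twice
  the number of common inversions. For the boundary roots, independence of x holds because equal
  cone types mean that the two inversion sets are disjoint from the same inversion sets, so along a
  reduced word both are met for the first time at the same letter.\<close>

fun alternating :: "'a \<Rightarrow> 'a \<Rightarrow> nat \<Rightarrow> 'a list" where
  "alternating s t 0 = []"
| "alternating s t (Suc k) = alternating t s k @ [t]"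

lemma length_alternating [simp]: "length (alternating s t k) = k"
  by (induction k arbitrary: s t) auto

lemma alternating_in_lists: "s \<in> S \<Longrightarrow> t \<in> S \<Longrightarrow> alternating s t k \<in> lists S"
  by (induction k arbitrary: s t) auto

text \<open>Words act with their last letter innermost, and \<open>alternating\<close> keeps that
  letter equal to \<open>t\<close>. Growing the word at the front composes one more reflection on
  the outside, which is what a recursion in the length needs; the parity of the length decides which
  letter is due.\<close>

lemma alternating_Cons:
  "alternating s t (Suc k) = (if even k then t else s) # alternating s t k"
proof (induction k arbitrary: s t)
  case (Suc k)
  have "alternating s t (Suc (Suc k)) = alternating t s (Suc k) @ [t]"
    by simp
  also have "alternating t s (Suc k) = (if even k then s else t) # alternating t s k"
    by (rule Suc.IH)
  finally show ?case by auto
qed simp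

text \<open>Isolates a suffix of length m in a longer alternating word, so that the braid relation
  applies to it.\<close>

lemma alternating_add_split:
  "\<exists>u. length u = j \<and> set u \<subseteq> {s, t} \<and> alternating s t (j + k) = u @ alternating s t k"
proof (induction k arbitrary: s t)
  case 0
  have "set (alternating s t j) \<subseteq> {s, t}"
    using alternating_in_lists[of s "{s, t}" t j] by (auto simp: in_lists_conv_set)
  then show ?case by auto
next
  case (Suc k)
  obtain u where "length u = j" "set u \<subseteq> {t, s}" "alternating t s (j + k) = u @ alternating t s k"
    using Suc.IH[of t s] by blast
  then show ?case by auto
qed

lemma alternating_double: "alternating s t (2 * m) = concat (replicate m [s, t])"
proof (induction m)
  case (Suc m)
  have "alternating s t (2 * Suc m) = s # t # alternating s t (2 * m)"
    using alternating_Cons[of s t "2 * m"] alternating_Cons[of s t "Suc (2 * m)"] by simp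
  then show ?case
    using Suc.IH by simp
qed simp

text \<open>The Chebyshev polynomials of the second kind, with the index shifted by one so that the
  value at 0 is 0. At cos \<theta> they are sin (k \<theta>) / sin \<theta>; at 1, which is the case
  of infinite m, they degenerate to k.\<close>

fun cheb :: "real \<Rightarrow> nat \<Rightarrow> real" where
  "cheb c 0 = 0"
| "cheb c (Suc 0) = 1"
| "cheb c (Suc (Suc k)) = 2 * c * cheb c (Suc k) - cheb c k"

lemma cheb_one: "cheb 1 k = real k"
  by (induction "1 :: real" k rule: cheb.induct) auto

lemma cheb_cos: "cheb (cos \<theta>) k * sin \<theta> = sin (real k * \<theta>)"
proof (induction "cos \<theta>" k rule: cheb.induct)
  case (3 k)
  have "sin (real (Suc (Suc k)) * \<theta>) + sin (real k * \<theta>)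
      = sin (real (Suc k) * \<theta> + \<theta>) + sin (real (Suc k) * \<theta> - \<theta>)"
    by (simp add: algebra_simps)
  also have "\<dots> = 2 * cos \<theta> * sin (real (Suc k) * \<theta>)"
    by (simp only: sin_add sin_diff) simp
  finally show ?case
    using 3 by (simp add: algebra_simps)
qed auto

section \<open>Coxeter systems: words and length\<close>

locale coxeter = group W for W :: "('a, 'b) monoid_scheme" (structure) +
  fixes S :: "'a set"
  assumes cox: "coxeter_system W S" and finS: "finite S"
begin

abbreviation value_of :: "'a list \<Rightarrow> 'a" where
  "value_of ss \<equiv> foldr (\<otimes>) ss \<one>"

abbreviation len :: "'a \<Rightarrow> nat" where
  "len \<equiv> cox_length W S"

abbreviation form :: "('a \<Rightarrow> real) \<Rightarrow> ('a \<Rightarrow> real) \<Rightarrow> real" where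
  "form \<equiv> root_form W S"

abbreviation word_act :: "'a list \<Rightarrow> ('a \<Rightarrow> real) \<Rightarrow> ('a \<Rightarrow> real)" where
  "word_act ss v \<equiv> foldr (reflect W S) ss v"

lemma gen_closed [simp]: "s \<in> S \<Longrightarrow> s \<in> carrier W"
  using cox unfolding coxeter_system_def by auto

lemma gen_sq [simp]:
  assumes "s \<in> S" shows "s \<otimes> s = \<one>"
proof -
  have "s [^] (2::nat) = \<one>"
    using cox assms pow_ord_eq_1[of s] unfolding coxeter_system_def by fastforce
  then show ?thesis
    using assms by (simp add: numeral_2_eq_2)
qed

lemma gen_inv [simp]: "s \<in> S \<Longrightarrow> inv s = s"
  by (simp add: inv_equality)

lemma gen_cancel [simp]: "s \<in> S \<Longrightarrow> w \<in> carrier W \<Longrightarrow> w \<otimes> s \<otimes> s = w"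
  by (simp add: m_assoc)

lemma cox_m_self [simp]: "s \<in> S \<Longrightarrow> cox_m W s s = 1"
  by (simp add: cox_m_def)

lemma cox_m_sym:
  assumes "s \<in> S" "t \<in> S" shows "cox_m W s t = cox_m W t s"
proof -
  have "inv (s \<otimes> t) = t \<otimes> s"
    using assms by (simp add: inv_mult_group)
  then show ?thesis
    using assms ord_inv[of "s \<otimes> t"] by (simp add: cox_m_def)
qed

lemma cox_m_neq_1:
  assumes "s \<in> S" "t \<in> S" "s \<noteq> t" shows "cox_m W s t \<noteq> 1"
proof
  assume "cox_m W s t = 1"
  then have "s \<otimes> t = \<one>"
    using assms ord_eq_1[of "s \<otimes> t"] by (simp add: cox_m_def)
  then have "s = inv t"
    using assms by (metis gen_closed inv_equality)
  then show False
    using assms by simp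
qed

lemma value_closed [simp]: "ss \<in> lists S \<Longrightarrow> value_of ss \<in> carrier W"
  by (induction ss) auto

lemma value_append:
  "us \<in> lists S \<Longrightarrow> vs \<in> lists S \<Longrightarrow> value_of (us @ vs) = value_of us \<otimes> value_of vs"
  by (induction us) (auto simp: m_assoc simp del: foldr_append simp flip: foldr_append)

lemma value_rev: "ss \<in> lists S \<Longrightarrow> value_of (rev ss) = inv (value_of ss)"
proof (induction ss)
  case (Cons s ss)
  then have "value_of (rev ss @ [s]) = value_of (rev ss) \<otimes> value_of [s]"
    by (intro value_append) auto
  then show ?case
    using Cons by (simp add: inv_mult_group)
qed simp

lemma value_signed:
  assumes "w \<in> signed_words S"
  shows "word_value W w = value_of (map fst w)"
proof -
  have "w \<in> lists (S \<times> UNIV)" using assms by (simp add: signed_words_def)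
  then show ?thesis
    by (induction w) (auto simp: word_value_def)
qed

lemma value_surj:
  assumes "w \<in> carrier W" shows "\<exists>ss \<in> lists S. value_of ss = w"
proof -
  have "w \<in> generate W S"
    using cox assms unfolding coxeter_system_def has_presentation_def by auto
  then show ?thesis
  proof induction
    case one
    then show ?case by (intro bexI[of _ "[]"]) auto
  next
    case (incl h)
    then show ?case by (intro bexI[of _ "[h]"]) auto
  next
    case (inv h)
    then show ?case by (intro bexI[of _ "[h]"]) auto
  next
    case (eng h1 h2)
    then obtain us vs where "us \<in> lists S" "value_of us = h1" "vs \<in> lists S" "value_of vs = h2"
      by auto
    then show ?case
      by (intro bexI[of _ "us @ vs"]) (simp_all only: value_append append_in_lists_conv)
  qed
qed

text \<open>Generators are involutions, so reversing a word inverts its value, and equality of two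
  values becomes triviality of one positive word. Here the presentation enters: any quantity
  invariant under the steps of \<open>pres_equiv\<close> can now be compared along words of equal
  value.\<close>

lemma pres_equiv_of_value_eq:
  assumes "us \<in> lists S" "vs \<in> lists S" "value_of us = value_of vs"
  shows "pres_equiv S (coxeter_relators W S) (map (\<lambda>s. (s, True)) (us @ rev vs)) []"
proof -
  let ?w = "map (\<lambda>s. (s, True)) (us @ rev vs)"
  have w: "?w \<in> signed_words S"
    using assms(1,2) by (auto simp: signed_words_def in_lists_conv_set)
  have "word_value W ?w = value_of (us @ rev vs)"
    unfolding value_signed[OF w] by (simp add: comp_def del: foldr_append)
  also have "\<dots> = value_of us \<otimes> inv (value_of vs)"
    using assms by (subst value_append) (auto simp: value_rev)
  also have "\<dots> = \<one>"
    using assms by simp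
  finally show ?thesis
    using w cox unfolding coxeter_system_def has_presentation_def by blast
qed

lemma coxeter_relatorE:
  assumes "r \<in> coxeter_relators W S"
  obtains s t where "s \<in> S" "t \<in> S" "cox_m W s t \<noteq> 0"
    "map fst r = alternating s t (2 * cox_m W s t)"
proof -
  obtain s t where st: "s \<in> S" "t \<in> S" "cox_m W s t \<noteq> 0"
    and r: "r = concat (replicate (cox_m W s t) [(s, True), (t, True)])"
    using assms by (auto simp: coxeter_relators_def)
  have "map fst r = alternating s t (2 * cox_m W s t)"
    unfolding r alternating_double by (simp add: map_concat)
  then show thesis
    using st that by blast
qed

text \<open>A cancellation removes 2 letters and a relator 2m letters, so parity survives. This is
  the sign character of W; it prevents multiplication by a generator from preserving length.\<close>

lemma pres_equiv_even:
  "pres_equiv S (coxeter_relators W S) w w' \<Longrightarrow> even (length w) = even (length w')"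
proof (induction rule: pres_equiv.induct)
  case (relator r u v)
  obtain s t where "map fst r = alternating s t (2 * cox_m W s t)"
    using coxeter_relatorE[OF relator] by blast
  then have "length r = 2 * cox_m W s t"
    by (metis length_alternating length_map)
  then show ?case by simp
qed auto

lemma value_eq_parity:
  assumes "us \<in> lists S" "vs \<in> lists S" "value_of us = value_of vs"
  shows "even (length us) = even (length vs)"
  using pres_equiv_even[OF pres_equiv_of_value_eq[OF assms]] by auto

section \<open>Length, parity and descents\<close>

lemma len_le: "ss \<in> lists S \<Longrightarrow> len (value_of ss) \<le> length ss"
  unfolding cox_length_def by (rule Least_le) auto

lemma reduced_word:
  assumes "w \<in> carrier W"
  obtains ss where "ss \<in> lists S" "length ss = len w" "value_of ss = w"
proof -
  have "\<exists>n. \<exists>ss \<in> lists S. length ss = n \<and> value_of ss = w"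
    using value_surj[OF assms] by auto
  from LeastI_ex[OF this] show thesis
    using that unfolding cox_length_def by blast
qed

lemma len_one [simp]: "len \<one> = 0"
  using len_le[of "[]"] by simp

lemma len_mult:
  assumes "x \<in> carrier W" "y \<in> carrier W" shows "len (x \<otimes> y) \<le> len x + len y"
proof -
  obtain us vs where uv: "us \<in> lists S" "length us = len x" "value_of us = x"
      "vs \<in> lists S" "length vs = len y" "value_of vs = y"
    using assms by (meson reduced_word)
  then have "value_of (us @ vs) = x \<otimes> y"
    using value_append by blast
  then show ?thesis
    using len_le[of "us @ vs"] uv by simp
qed

lemma len_gen: "s \<in> S \<Longrightarrow> len s \<le> 1"
  using len_le[of "[s]"] by simp

lemma len_inv [simp]:
  assumes "x \<in> carrier W" shows "len (inv x) = len x"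
proof -
  have le: "len (inv y) \<le> len y" if y: "y \<in> carrier W" for y
  proof -
    obtain ss where "ss \<in> lists S" "length ss = len y" "value_of ss = y"
      using y by (meson reduced_word)
    then show ?thesis
      using len_le[of "rev ss"] value_rev[of ss] by (simp add: in_lists_conv_set)
  qed
  show ?thesis
    using le[OF assms] le[of "inv x"] assms by simp
qed

lemma len_parity:
  assumes "w \<in> carrier W" "s \<in> S" shows "even (len (w \<otimes> s)) \<longleftrightarrow> odd (len w)"
proof -
  obtain us where us: "us \<in> lists S" "length us = len w" "value_of us = w"
    using assms by (meson reduced_word)
  obtain vs where vs: "vs \<in> lists S" "length vs = len (w \<otimes> s)" "value_of vs = w \<otimes> s"
    using assms by (meson reduced_word m_closed gen_closed)
  have "value_of (us @ [s]) = value_of vs"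
    using us vs assms value_append[of us "[s]"] by simp
  then show ?thesis
    using value_eq_parity[of "us @ [s]" vs] us vs assms by auto
qed

lemma len_gen_cases:
  assumes "w \<in> carrier W" "s \<in> S"
  shows "len (w \<otimes> s) = len w + 1 \<or> len (w \<otimes> s) + 1 = len w"
proof -
  have "len (w \<otimes> s) \<le> len w + 1"
    using len_mult[of w s] len_gen[of s] assms by simp
  moreover have "len w \<le> len (w \<otimes> s) + 1"
    using len_mult[of "w \<otimes> s" s] len_gen[of s] assms by simp
  moreover have "len (w \<otimes> s) \<noteq> len w"
    using len_parity[OF assms] by auto
  ultimately show ?thesis by linarith
qed

lemma descent_exists:
  assumes "w \<in> carrier W" "w \<noteq> \<one>"
  obtains s where "s \<in> S" "len (w \<otimes> s) + 1 = len w"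
proof -
  obtain us where us: "us \<in> lists S" "length us = len w" "value_of us = w"
    using assms by (meson reduced_word)
  then have "us \<noteq> []" using assms by auto
  then obtain vs s where vs: "us = vs @ [s]" by (meson rev_exhaust)
  then have s: "s \<in> S" and vsS: "vs \<in> lists S" using us by auto
  have "w = value_of vs \<otimes> s"
    using us vs s vsS value_append[of vs "[s]"] by auto
  then have "w \<otimes> s = value_of vs"
    using s vsS by simp
  then have "len (w \<otimes> s) \<le> length vs"
    using len_le[OF vsS] by simp
  then have "len (w \<otimes> s) + 1 \<le> len w"
    using us vs by simp
  then show thesis
    using that[OF s] len_gen_cases[OF assms(1) s] by simp
qed

text \<open>Induction along a reduced word: a nontrivial element loses a descent on the right, and
  read backwards each step is an ascent. Inversion sets gain one root per step.\<close>

lemma ascent_induct [consumes 1, case_names one step]: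
  assumes "w \<in> carrier W" and "P \<one>"
    and step: "\<And>v s. v \<in> carrier W \<Longrightarrow> s \<in> S \<Longrightarrow> len (v \<otimes> s) = len v + 1 \<Longrightarrow> P v \<Longrightarrow> P (v \<otimes> s)"
  shows "P w"
  using assms(1)
proof (induction "len w" arbitrary: w rule: less_induct)
  case less
  show ?case
  proof (cases "w = \<one>")
    case False
    then obtain s where s: "s \<in> S" "len (w \<otimes> s) + 1 = len w"
      using descent_exists less.prems by blast
    then have "P (w \<otimes> s)"
      using less by simp
    then show ?thesis
      using step[of "w \<otimes> s" s] s less.prems by simp
  qed (simp add: assms(2))
qed

section \<open>The geometric representation\<close>

lemma form_linear_left:
  "form (\<lambda>r. a * u r + b * v r) w = a * form u w + b * form v w"
  by (simp add: root_form_def sum.distrib sum_distrib_left algebra_simps)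

lemma gram_sym: "s \<in> S \<Longrightarrow> t \<in> S \<Longrightarrow> gram W s t = gram W t s"
  by (simp add: gram_def cox_m_sym)

lemma gram_self [simp]: "s \<in> S \<Longrightarrow> gram W s s = 1"
  by (simp add: gram_def)

lemma form_sym: "form u v = form v u"
  unfolding root_form_def
  by (subst sum.swap) (auto intro!: sum.cong simp: gram_sym)

lemma form_linear_right:
  "form w (\<lambda>r. a * u r + b * v r) = a * form w u + b * form w v"
  by (metis form_sym form_linear_left)

lemma form_simple [simp]:
  assumes "s \<in> S" "t \<in> S" shows "form (simple_root s) (simple_root t) = gram W s t"
proof -
  have "form (simple_root s) (simple_root t)
      = (\<Sum>i\<in>S. \<Sum>j\<in>S. if j = t then (if i = s then gram W i j else 0) else 0)"
    unfolding root_form_def simple_root_def by (intro sum.cong refl) auto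
  then show ?thesis
    using assms finS by simp
qed

lemma reflect_linear:
  "reflect W S s (\<lambda>r. a * u r + b * v r) = (\<lambda>r. a * reflect W S s u r + b * reflect W S s v r)"
  by (simp add: reflect_def form_linear_left algebra_simps)

text \<open>Keeps the factor 1 so that the right-hand side has the literal shape
  \<open>a * u r + b * v r\<close> of the linearity lemmas and can be unfolded with them.\<close>

lemma reflect_eq:
  "reflect W S s v = (\<lambda>r. 1 * v r + (- 2 * form v (simple_root s)) * simple_root s r)"
  by (simp add: reflect_def)

lemma reflect_form:
  assumes "s \<in> S" shows "form (reflect W S s u) (reflect W S s v) = form u v"
  unfolding reflect_eq form_linear_left form_linear_right
  using assms by (simp add: form_sym[of "simple_root s" v] algebra_simps)

lemma reflect_simple:
  assumes "s \<in> S" "t \<in> S"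
  shows "reflect W S s (simple_root t) = (\<lambda>r. simple_root t r - 2 * gram W s t * simple_root s r)"
  using assms by (simp add: reflect_def gram_sym)

lemma reflect_self: "s \<in> S \<Longrightarrow> reflect W S s (simple_root s) = (\<lambda>r. - simple_root s r)"
  by (simp add: reflect_simple)

lemma reflect_reflect [simp]:
  assumes "s \<in> S" shows "reflect W S s (reflect W S s v) = v"
proof -
  have "form (reflect W S s v) (simple_root s) = - form v (simple_root s)"
    unfolding reflect_eq form_linear_left using assms by simp
  then show ?thesis
    by (simp add: reflect_def)
qed

lemma reflect_orthogonal: "form v (simple_root s) = 0 \<Longrightarrow> reflect W S s v = v"
  by (simp add: reflect_def)

lemma reflect_root_space:
  assumes "s \<in> S" "v \<in> root_space S" shows "reflect W S s v \<in> root_space S"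
  using assms by (auto simp: root_space_def reflect_def simple_root_def)

lemma word_act_linear:
  "word_act ss (\<lambda>r. a * u r + b * v r) = (\<lambda>r. a * word_act ss u r + b * word_act ss v r)"
  by (induction ss) (auto simp: reflect_linear)

lemma word_act_root_space:
  "ss \<in> lists S \<Longrightarrow> v \<in> root_space S \<Longrightarrow> word_act ss v \<in> root_space S"
  by (induction ss) (auto simp: reflect_root_space)

lemma word_act_rev:
  "ss \<in> lists S \<Longrightarrow> word_act (rev ss) (word_act ss v) = v"
  by (induction ss arbitrary: v) auto

lemma word_act_fixed:
  assumes "\<And>s. s \<in> set ss \<Longrightarrow> form v (simple_root s) = 0" shows "word_act ss v = v"
  using assms by (induction ss) (auto simp: reflect_orthogonal)

text \<open>The next reflection leaves the coefficient of \<open>?x\<close> alone and replaces that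
  of \<open>?y\<close> by 2 c times the former minus the latter, where c is
  \<open>- gram W s t\<close>. This is the three-term recurrence of \<open>cheb\<close>. The two
  letters exchange roles at every step, hence the parity cases.\<close>

lemma word_act_alternating:
  assumes "s \<in> S" "t \<in> S"
  shows "word_act (alternating s t k) (simple_root s) = (\<lambda>r.
    cheb (- gram W s t) (Suc k) * simple_root (if even k then s else t) r +
    cheb (- gram W s t) k * simple_root (if even k then t else s) r)"
proof (induction k)
  case (Suc k)
  let ?c = "cheb (- gram W s t)"
  let ?x = "if even k then s else t" and ?y = "if even k then t else s"
  have xy: "?x \<in> S" "?y \<in> S" "gram W ?y ?x = gram W s t"
    using assms gram_sym by auto
  have "word_act (alternating s t (Suc k)) (simple_root s)
      = reflect W S ?y (word_act (alternating s t k) (simple_root s))"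
    unfolding alternating_Cons by simp
  also have "\<dots> = (\<lambda>r. ?c (Suc k) * reflect W S ?y (simple_root ?x) r
      + ?c k * reflect W S ?y (simple_root ?y) r)"
    unfolding Suc.IH reflect_linear ..
  also have "\<dots> = (\<lambda>r. ?c (Suc k) * simple_root ?x r + ?c (Suc (Suc k)) * simple_root ?y r)"
    unfolding reflect_simple[OF xy(2) xy(1)] reflect_self[OF xy(2)] xy(3)
    by (simp add: algebra_simps)
  finally show ?case by auto
qed simp

section \<open>Relators act trivially\<close>

lemma sin_pi_div_cox_m:
  assumes "s \<in> S" "t \<in> S" "s \<noteq> t" "cox_m W s t \<noteq> 0"
  shows "0 < sin (pi / cox_m W s t)"
proof -
  have "real (cox_m W s t) \<ge> 2"
    using assms cox_m_neq_1[of s t] by simp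
  then show ?thesis
    by (intro sin_gt_zero) (auto simp: field_simps)
qed

lemma cheb_gram:
  assumes "s \<in> S" "t \<in> S" "s \<noteq> t" "cox_m W s t \<noteq> 0"
  shows "cheb (- gram W s t) k = sin (real k * (pi / cox_m W s t)) / sin (pi / cox_m W s t)"
  using cheb_cos[of "pi / cox_m W s t" k] sin_pi_div_cox_m[OF assms] assms(4)
  by (simp add: gram_def field_simps)

lemma word_act_relator_simple:
  assumes "s \<in> S" "t \<in> S" "s \<noteq> t" "cox_m W s t \<noteq> 0"
  shows "word_act (alternating s t (2 * cox_m W s t)) (simple_root s) = simple_root s"
    and "word_act (alternating s t (2 * cox_m W s t)) (simple_root t) = simple_root t"
proof -
  define m where "m = cox_m W s t"
  define \<theta> where "\<theta> = pi / real m"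
  have m: "m > 0" using assms by (simp add: m_def)
  have m\<theta>: "real m * \<theta> = pi" using m by (simp add: \<theta>_def)
  have sin: "sin \<theta> > 0"
    using sin_pi_div_cox_m[OF assms] by (simp add: \<theta>_def m_def)
  have c: "cheb (- gram W s t) k = sin (real k * \<theta>) / sin \<theta>" for k
    using cheb_gram[OF assms] by (simp add: \<theta>_def m_def)
  have 0: "cheb (- gram W s t) (2 * m) = 0"
    using m\<theta> by (simp add: c mult.assoc)
  have "real (Suc (2 * m)) * \<theta> = \<theta> + 2 * pi"
    using m\<theta> by (simp add: algebra_simps)
  then have 1: "cheb (- gram W s t) (Suc (2 * m)) = 1"
    unfolding c using sin by (simp del: of_nat_Suc)
  obtain k where k: "2 * m = Suc k" using m by (cases "2 * m") auto
  then have "odd k" by presburger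
  have "real k = 2 * real m - 1" using k by linarith
  then have "real k * \<theta> = 2 * (real m * \<theta>) - \<theta>"
    by (simp only:) (simp add: algebra_simps)
  then have "real k * \<theta> = 2 * pi - \<theta>"
    by (simp only: m\<theta>)
  then have 2: "cheb (- gram W s t) k = - 1"
    unfolding c using sin by (simp add: sin_diff)
  show "word_act (alternating s t (2 * cox_m W s t)) (simple_root s) = simple_root s"
    unfolding m_def[symmetric] word_act_alternating[OF assms(1,2)] 0 1 by simp
  \<comment> \<open>The coefficient formula starts from the root of the letter that is not last. So
    the last letter \<open>t\<close> acts first and negates its root; what remains is an alternating
    word of odd length k = 2m - 1 ending in \<open>s\<close>, whose coefficients 0 and -1 undo the
    sign.\<close>
  have "word_act (alternating s t (2 * m)) (simple_root t)
      = word_act (alternating t s k) (reflect W S t (simple_root t))"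
    by (simp add: k)
  also have "reflect W S t (simple_root t) = (\<lambda>r. (- 1) * simple_root t r + 0 * simple_root t r)"
    using assms by (simp add: reflect_self)
  also have "word_act (alternating t s k) \<dots>
      = (\<lambda>r. (- 1) * word_act (alternating t s k) (simple_root t) r)"
    unfolding word_act_linear by simp
  also have "\<dots> = simple_root t"
    unfolding word_act_alternating[OF assms(2,1)] gram_sym[OF assms(2,1)] k[symmetric] 0 2
    using \<open>odd k\<close> by simp
  finally show "word_act (alternating s t (2 * cox_m W s t)) (simple_root t) = simple_root t"
    by (simp add: m_def)
qed

text \<open>Positivity of the determinant of the form on the plane of the two simple roots, which is
  the square of sin (pi/m).\<close>

lemma gram_sq_less_1:
  assumes "s \<in> S" "t \<in> S" "s \<noteq> t" "cox_m W s t \<noteq> 0"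
  shows "gram W s t * gram W s t < 1"
proof -
  have "0 < (sin (pi / cox_m W s t))\<^sup>2"
    using sin_pi_div_cox_m[OF assms] by (simp add: zero_less_power)
  then show ?thesis
    using assms(4) sin_cos_squared_add[of "pi / cox_m W s t"]
    by (simp add: gram_def power2_eq_square)
qed

text \<open>The relator fixes the plane of the two simple roots pointwise, and both reflections fix its
  orthogonal complement; the form is nondegenerate on the plane, so these two subspaces span.\<close>

lemma word_act_relator:
  assumes "s \<in> S" "t \<in> S" "cox_m W s t \<noteq> 0"
  shows "word_act (alternating s t (2 * cox_m W s t)) v = v"
proof (cases "s = t")
  case True
  then have "alternating s t (2 * cox_m W s t) = [s, s]"
    using assms by (simp add: numeral_2_eq_2)
  then show ?thesis using assms by simp
next
  case False
  let ?w = "alternating s t (2 * cox_m W s t)"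
  define g where "g = gram W s t"
  define x where "x = form v (simple_root s)"
  define y where "y = form v (simple_root t)"
  \<comment> \<open>\<open>a\<close> and \<open>b\<close> are the coordinates of the orthogonal
    projection of \<open>v\<close> to the plane, obtained by Cramer's rule from its products x and y
    with the two simple roots; \<open>q\<close> is the orthogonal remainder.\<close>
  define a where "a = (x - g * y) / (1 - g * g)"
  define b where "b = (y - g * x) / (1 - g * g)"
  define p where "p = (\<lambda>r. a * simple_root s r + b * simple_root t r)"
  define q where "q = (\<lambda>r. 1 * v r + (- 1) * p r)"
  have g: "1 - g * g \<noteq> 0"
    using gram_sq_less_1[OF assms(1,2) False assms(3)] by (simp add: g_def)
  have "a + b * g = (x - g * y + (y - g * x) * g) / (1 - g * g)"
    by (simp only: a_def b_def add_divide_distrib times_divide_eq_left)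
  also have "x - g * y + (y - g * x) * g = x * (1 - g * g)"
    by (simp add: algebra_simps)
  finally have ab1: "a + b * g = x"
    using g by simp
  have "a * g + b = ((x - g * y) * g + (y - g * x)) / (1 - g * g)"
    by (simp only: a_def b_def add_divide_distrib times_divide_eq_left)
  also have "(x - g * y) * g + (y - g * x) = y * (1 - g * g)"
    by (simp add: algebra_simps)
  finally have ab2: "a * g + b = y"
    using g by simp
  have "form q (simple_root s) = 0" "form q (simple_root t) = 0"
    unfolding q_def p_def form_linear_left
    using assms ab1 ab2 gram_sym[of t s] by (simp_all add: g_def x_def y_def)
  then have q: "word_act ?w q = q"
    using alternating_in_lists[of s "{s, t}" t "2 * cox_m W s t"]
    by (intro word_act_fixed) (fastforce simp: in_lists_conv_set)
  have p: "word_act ?w p = p"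
    unfolding p_def word_act_linear word_act_relator_simple[OF assms(1,2) False assms(3)] ..
  have v: "v = (\<lambda>r. 1 * p r + 1 * q r)"
    by (simp add: q_def)
  show ?thesis
    by (subst (1 2) v) (simp only: word_act_linear p q)
qed

lemma pres_equiv_act:
  "pres_equiv S (coxeter_relators W S) w w' \<Longrightarrow> word_act (map fst w) v = word_act (map fst w') v"
proof (induction arbitrary: v rule: pres_equiv.induct)
  case (relator r u v)
  then show ?case
    by (elim coxeter_relatorE) (simp add: word_act_relator)
qed auto

lemma word_act_value_eq:
  assumes "us \<in> lists S" "vs \<in> lists S" "value_of us = value_of vs"
  shows "word_act us v = word_act vs v"
proof -
  have "word_act (us @ rev vs) (word_act vs v) = word_act vs v"
    using pres_equiv_act[OF pres_equiv_of_value_eq[OF assms], of "word_act vs v"]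
    by (simp add: comp_def)
  then show ?thesis
    using word_act_rev[OF assms(2)] by simp
qed

text \<open>The witness that the choice in \<open>cox_act\<close> can be satisfied. Any word for
  \<open>w\<close> serves, since words of equal value act equally. The restriction to
  \<open>root_space S\<close> makes the maps extensional, as elements of \<open>BijGroup\<close>
  must be.\<close>

definition rep :: "'a \<Rightarrow> ('a \<Rightarrow> real) \<Rightarrow> ('a \<Rightarrow> real)" where
  "rep w = (\<lambda>v \<in> root_space S. word_act (SOME ss. ss \<in> lists S \<and> value_of ss = w) v)"

lemma rep_value:
  assumes "ss \<in> lists S" "v \<in> root_space S"
  shows "rep (value_of ss) v = word_act ss v"
proof -
  let ?us = "SOME us. us \<in> lists S \<and> value_of us = value_of ss"
  have "?us \<in> lists S \<and> value_of ?us = value_of ss"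
    using assms(1) by (intro someI_ex[of "\<lambda>us. us \<in> lists S \<and> value_of us = value_of ss"]) auto
  then show ?thesis
    using assms word_act_value_eq[of ?us ss v] by (simp add: rep_def)
qed

lemma rep_bij:
  assumes "w \<in> carrier W" shows "rep w \<in> Bij (root_space S)"
proof -
  obtain ss where ss: "ss \<in> lists S" "value_of ss = w"
    using value_surj[OF assms] by auto
  then have ssr: "rev ss \<in> lists S" by (simp add: in_lists_conv_set)
  have "bij_betw (word_act ss) (root_space S) (root_space S)"
    using word_act_root_space[OF ss(1)] word_act_root_space[OF ssr]
      word_act_rev[OF ss(1)] word_act_rev[OF ssr]
    by (intro bij_betw_byWitness[where f' = "word_act (rev ss)"]) auto
  then have "bij_betw (rep w) (root_space S) (root_space S)"
    using rep_value[OF ss(1)] ss(2) by (subst bij_betw_cong[of _ _ "word_act ss"]) auto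
  then show ?thesis
    by (simp add: Bij_def rep_def)
qed

lemma rep_mult:
  assumes "x \<in> carrier W" "y \<in> carrier W"
  shows "rep (x \<otimes> y) = compose (root_space S) (rep x) (rep y)"
proof
  fix v
  obtain us vs where uv: "us \<in> lists S" "value_of us = x" "vs \<in> lists S" "value_of vs = y"
    using value_surj assms by meson
  then have "value_of (us @ vs) = x \<otimes> y"
    using value_append by blast
  then have "rep (x \<otimes> y) v = rep x (rep y v)" if "v \<in> root_space S"
    using rep_value[of "us @ vs" v] rep_value[of vs v] rep_value[of us "word_act vs v"]
      word_act_root_space[of vs v] uv that by simp
  then show "rep (x \<otimes> y) v = compose (root_space S) (rep x) (rep y) v"
    by (cases "v \<in> root_space S") (auto simp: compose_def rep_def)
qed

lemma rep_group_action: "group_action W (root_space S) rep"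
proof -
  have "rep \<in> hom W (BijGroup (root_space S))"
    using rep_bij rep_mult by (auto simp: hom_def BijGroup_def)
  then show ?thesis
    using group_BijGroup is_group
    by (simp add: group_action_def group_hom_def group_hom_axioms_def)
qed

section \<open>The action of the group on the root space\<close>

abbreviation act :: "'a \<Rightarrow> ('a \<Rightarrow> real) \<Rightarrow> ('a \<Rightarrow> real)" where
  "act \<equiv> cox_act W S"

lemma act_spec:
  "group_action W (root_space S) act \<and>
    (\<forall>s \<in> S. \<forall>v \<in> root_space S. act s v = reflect W S s v)"
proof -
  have "rep s v = reflect W S s v" if "s \<in> S" "v \<in> root_space S" for s v
    using rep_value[of "[s]" v] that by simp
  then have "group_action W (root_space S) rep \<and>
    (\<forall>s \<in> S. \<forall>v \<in> root_space S. rep s v = reflect W S s v)"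
    using rep_group_action by blast
  then show ?thesis
    unfolding cox_act_def
    by (rule someI[where P = "\<lambda>\<rho>. group_action W (root_space S) \<rho> \<and>
      (\<forall>s \<in> S. \<forall>v \<in> root_space S. \<rho> s v = reflect W S s v)"])
qed

sublocale act: group_action W "root_space S" act
  using act_spec by blast

lemma act_gen: "s \<in> S \<Longrightarrow> v \<in> root_space S \<Longrightarrow> act s v = reflect W S s v"
  using act_spec by blast

lemma act_closed: "w \<in> carrier W \<Longrightarrow> v \<in> root_space S \<Longrightarrow> act w v \<in> root_space S"
  by (rule act.element_image) auto

lemma act_one [simp]: "v \<in> root_space S \<Longrightarrow> act \<one> v = v"
  using act.id_eq_one by (metis restrict_apply')

lemma act_mult:
  "x \<in> carrier W \<Longrightarrow> y \<in> carrier W \<Longrightarrow> v \<in> root_space S \<Longrightarrow> act (x \<otimes> y) v = act x (act y v)"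
  by (rule act.composition_rule)

lemma act_value:
  "ss \<in> lists S \<Longrightarrow> v \<in> root_space S \<Longrightarrow> act (value_of ss) v = word_act ss v"
  by (induction ss) (auto simp: act_mult act_gen word_act_root_space)

lemma act_inv_cancel:
  assumes "w \<in> carrier W" "v \<in> root_space S"
  shows "act (inv w) (act w v) = v" "act w (act (inv w) v) = v"
  using assms act_mult[of "inv w" w v] act_mult[of w "inv w" v] by simp_all

lemma root_space_linear:
  "u \<in> root_space S \<Longrightarrow> v \<in> root_space S \<Longrightarrow> (\<lambda>r. a * u r + b * v r) \<in> root_space S"
  by (simp add: root_space_def)

lemma act_linear:
  assumes "w \<in> carrier W" "u \<in> root_space S" "v \<in> root_space S"
  shows "act w (\<lambda>r. a * u r + b * v r) = (\<lambda>r. a * act w u r + b * act w v r)"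
proof -
  obtain ss where "ss \<in> lists S" "value_of ss = w"
    using value_surj assms by meson
  then show ?thesis
    using act_value[of ss] word_act_linear[of ss a u b v] root_space_linear assms by auto
qed

lemma act_uminus:
  assumes "w \<in> carrier W" "v \<in> root_space S"
  shows "act w (\<lambda>r. - v r) = (\<lambda>r. - act w v r)"
  using act_linear[OF assms assms(2), of "- 1" 0] by simp

lemma act_form:
  assumes "w \<in> carrier W" "u \<in> root_space S" "v \<in> root_space S"
  shows "form (act w u) (act w v) = form u v"
proof -
  have *: "form (word_act ss u) (word_act ss v) = form u v" if "ss \<in> lists S" for ss
    using that by (induction ss) (auto simp: reflect_form)
  obtain ss where "ss \<in> lists S" "value_of ss = w"
    using value_surj assms by meson
  then show ?thesis
    using * act_value[of ss] assms by auto
qed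

lemma simple_root_space [simp]: "s \<in> S \<Longrightarrow> simple_root s \<in> root_space S"
  by (auto simp: root_space_def simple_root_def)

section \<open>Positivity\<close>

lemma value_alternating_Suc:
  assumes "s \<in> S" "t \<in> S"
  shows "value_of (alternating s t (Suc k)) = value_of (alternating t s k) \<otimes> t"
  using assms alternating_in_lists[of t S s k] value_append[of "alternating t s k" "[t]"] by simp

lemma value_alternating_closed:
  "s \<in> S \<Longrightarrow> t \<in> S \<Longrightarrow> value_of (alternating s t k) \<in> carrier W"
  by (simp add: alternating_in_lists)

lemma value_alternating_double:
  assumes "s \<in> S" "t \<in> S" shows "value_of (alternating s t (2 * m)) = (s \<otimes> t) [^] m"
proof -
  have st: "s \<otimes> t \<in> carrier W"
    using assms by simp
  show ?thesis
    unfolding alternating_double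
  proof (induction m)
    case (Suc m)
    have "value_of (concat (replicate (Suc m) [s, t])) = (s \<otimes> t) \<otimes> (s \<otimes> t) [^] m"
      using Suc assms by (simp add: m_assoc)
    also have "\<dots> = (s \<otimes> t) [^] Suc m"
      using st by (metis nat_pow_Suc2)
    finally show ?case .
  qed simp
qed

text \<open>Start from the trivial alternating word of length 2m and move its last letters one by
  one to the other side; after m moves both sides have length m. Each move exchanges the roles of s
  and t, so the induction carries both equations. For infinite m the value 0 makes both words
  empty.\<close>

lemma braid_relation:
  assumes "s \<in> S" "t \<in> S"
  shows "value_of (alternating s t (cox_m W s t)) = value_of (alternating t s (cox_m W s t))"
proof -
  define m where "m = cox_m W s t"
  have one: "value_of (alternating s t (2 * m)) = \<one>" "value_of (alternating t s (2 * m)) = \<one>"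
    using assms cox_m_sym[of s t] pow_ord_eq_1[of "s \<otimes> t"] pow_ord_eq_1[of "t \<otimes> s"]
    by (auto simp: value_alternating_double m_def cox_m_def)
  have peel: "value_of (alternating y x n) = value_of (alternating x y (Suc j))"
    if "x \<in> S" "y \<in> S" "value_of (alternating x y (Suc n)) = value_of (alternating y x j)"
    for x y n j
  proof -
    have "value_of (alternating y x n) = value_of (alternating x y (Suc n)) \<otimes> y"
      unfolding value_alternating_Suc[OF that(1,2)]
      using that(1,2) value_alternating_closed by simp
    also have "\<dots> = value_of (alternating y x j) \<otimes> y"
      by (simp only: that(3))
    also have "\<dots> = value_of (alternating x y (Suc j))"
      by (simp only: value_alternating_Suc[OF that(1,2)])
    finally show ?thesis .
  qed
  have "value_of (alternating s t (2 * m - j)) = value_of (alternating t s j) \<and>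
      value_of (alternating t s (2 * m - j)) = value_of (alternating s t j)" if "j \<le> 2 * m" for j
    using that
  proof (induction j)
    case 0
    then show ?case using one by simp
  next
    case (Suc j)
    then have n: "2 * m - j = Suc (2 * m - Suc j)" and "j \<le> 2 * m" by simp_all
    note IH = Suc.IH[OF \<open>j \<le> 2 * m\<close>, unfolded n]
    show ?case
      using peel[OF assms IH[THEN conjunct1]] peel[OF assms(2,1) IH[THEN conjunct2]] by blast
  qed
  from this[of m, THEN conjunct1] show ?thesis
    by (simp add: m_def)
qed

text \<open>For k at most m the angle k pi/m stays within [0, pi], where the sine is nonnegative.
  For infinite m the value is k itself.\<close>

lemma cheb_gram_nonneg:
  assumes "s \<in> S" "t \<in> S" "s \<noteq> t" "cox_m W s t \<noteq> 0 \<Longrightarrow> k \<le> cox_m W s t"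
  shows "0 \<le> cheb (- gram W s t) k"
proof (cases "cox_m W s t = 0")
  case True
  then show ?thesis by (simp add: gram_def cheb_one)
next
  case False
  then have "real k * (pi / cox_m W s t) \<le> pi"
    using assms by (simp add: field_simps)
  then have "0 \<le> sin (real k * (pi / cox_m W s t))"
    by (intro sin_ge_zero) auto
  then show ?thesis
    using cheb_gram[OF assms(1-3) False] sin_pi_div_cox_m[OF assms(1-3) False] by simp
qed

text \<open>If k were at least m, the braid relation would rewrite the last m letters into a word
  ending in \<open>s\<close>. That letter cancels in \<open>w \<otimes> s\<close>, which is then
  shorter than \<open>w\<close>, against the ascent.\<close>

lemma alternating_ascent_bound:
  assumes "s \<in> S" "t \<in> S" "s \<noteq> t" "cox_m W s t \<noteq> 0"
    and "v \<in> carrier W" "w = v \<otimes> value_of (alternating s t k)" "len w = len v + k"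
    and "len w < len (w \<otimes> s)"
  shows "k < cox_m W s t"
proof (rule ccontr)
  define m where "m = cox_m W s t"
  assume "\<not> k < cox_m W s t"
  then obtain j where k: "k = j + m"
    unfolding m_def by (metis add.commute le_Suc_ex not_less)
  obtain n where n: "m = Suc n"
    using assms(4) unfolding m_def by (cases "cox_m W s t") auto
  obtain u where u: "length u = j" "set u \<subseteq> {s, t}"
      "alternating s t k = u @ alternating s t m"
    using alternating_add_split unfolding k by metis
  have uS: "u \<in> lists S" using u assms by auto
  let ?a = "value_of (alternating s t n)"
  have a: "?a \<in> carrier W" using assms value_alternating_closed by blast
  have "value_of (alternating s t m) = ?a \<otimes> s"
    using braid_relation[OF assms(1,2)] value_alternating_Suc[of t s n] assms n by (simp add: m_def)
  then have "w \<otimes> s = v \<otimes> (value_of u \<otimes> ?a)"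
    using assms u uS a value_append[of u "alternating s t m"] alternating_in_lists[of s S t m]
    by (simp add: m_assoc del: foldr_append)
  moreover have "len (v \<otimes> (value_of u \<otimes> ?a)) \<le> len v + (j + n)"
    using len_mult[of v "value_of u \<otimes> ?a"] len_mult[of "value_of u" ?a] len_le[OF uS]
      len_le[OF alternating_in_lists[of s S t n]] assms a uS u(1) by simp
  ultimately show False
    using assms k n by simp
qed

text \<open>Split off from \<open>w\<close> the longest possible alternating suffix in \<open>s\<close> and a descent \<open>t\<close>.
  The remaining factor \<open>v\<close> has neither \<open>s\<close> nor \<open>t\<close> as a descent, and the suffix maps the
  simple root of \<open>s\<close> to a nonnegative combination of the two simple roots.\<close>

theorem ascent_nonneg:
  assumes "w \<in> carrier W" "s \<in> S" "len w < len (w \<otimes> s)"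
  shows "0 \<le> act w (simple_root s) r"
  using assms
proof (induction "len w" arbitrary: w s rule: less_induct)
  case less
  show ?case
  proof (cases "w = \<one>")
    case True
    then have "act w (simple_root s) = simple_root s"
      using less.prems by simp
    then show ?thesis
      by (simp add: simple_root_def)
  next
    case False
    then obtain t where t: "t \<in> S" "len (w \<otimes> t) + 1 = len w"
      using descent_exists less.prems by blast
    have st: "s \<in> S" "s \<noteq> t" using t less.prems by auto
    let ?A = "\<lambda>k. value_of (alternating s t k)"
    define P where "P = (\<lambda>(v, k). v \<in> carrier W \<and> w = v \<otimes> ?A k \<and> len w = len v + k \<and> k > 0)"
    have "P (w \<otimes> t, 1)"
      using t less.prems by (simp add: P_def)
    \<comment> \<open>Least length of \<open>v\<close> means longest suffix. The condition k > 0 in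
      \<open>P\<close> keeps \<open>v\<close> shorter than \<open>w\<close>, so the induction
      hypothesis applies to it.\<close>
    then obtain v k where vk: "P (v, k)" and min: "\<And>v' k'. P (v', k') \<Longrightarrow> len v \<le> len v'"
      using ex_has_least_nat[of P "(w \<otimes> t, 1)" "\<lambda>(v, k). len v"] by auto
    then have v: "v \<in> carrier W" and w: "w = v \<otimes> ?A k" and lw: "len w = len v + k" and k: "k > 0"
      by (auto simp: P_def)
    let ?x = "if even k then s else t" and ?y = "if even k then t else s"
    have xy: "?x \<in> S" "?y \<in> S" using st t by auto
    have A: "?A n \<in> carrier W" for n
      using st t value_alternating_closed by blast
    \<comment> \<open>A descent \<open>?y\<close> of \<open>v\<close> could be moved into the
      suffix, which it continues at the front, against minimality.\<close>
    have "len (v \<otimes> ?y) = len v + 1"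
    proof (rule ccontr)
      assume "\<not> ?thesis"
      then have "len (v \<otimes> ?y) + 1 = len v"
        using len_gen_cases[OF v xy(2)] by blast
      moreover have "w = (v \<otimes> ?y) \<otimes> ?A (Suc k)"
        unfolding alternating_Cons using w v xy A
        by (simp add: m_assoc flip: m_assoc[of ?y ?y])
      ultimately have "P (v \<otimes> ?y, Suc k)"
        using v xy lw by (simp add: P_def)
      then show False
        using min \<open>len (v \<otimes> ?y) + 1 = len v\<close> by fastforce
    qed
    then have y: "0 \<le> act v (simple_root ?y) r"
      using less.hyps[of v ?y] v xy lw k by simp
    \<comment> \<open>\<open>?x\<close> is the first letter of the suffix. Were it a descent of
      \<open>v\<close>, moving it into \<open>v\<close> would shorten both factors and bound the
      length of \<open>w\<close> by \<open>len v + k - 2\<close>.\<close>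
    have "len (v \<otimes> ?x) = len v + 1"
    proof (rule ccontr)
      assume "\<not> ?thesis"
      then have "len (v \<otimes> ?x) + 1 = len v"
        using len_gen_cases[OF v xy(1)] by blast
      moreover obtain j where j: "k = Suc j"
        using k by (cases k) auto
      have "?A k = ?x \<otimes> ?A j"
        unfolding j alternating_Cons by simp
      then have "w = (v \<otimes> ?x) \<otimes> ?A j"
        using w v xy A by (simp add: m_assoc)
      then have "len w \<le> len (v \<otimes> ?x) + len (?A j)"
        using len_mult[of "v \<otimes> ?x" "?A j"] v xy A by simp
      moreover have "len (?A j) \<le> j"
        using len_le[of "alternating s t j"] alternating_in_lists[of s S t j] st t by simp
      ultimately show False
        using lw j by linarith
    qed
    then have x: "0 \<le> act v (simple_root ?x) r"
      using less.hyps[of v ?x] v xy lw k by simp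
    have "k < cox_m W s t" if "cox_m W s t \<noteq> 0"
      using alternating_ascent_bound[OF st(1) t(1) st(2) that v w lw] less.prems by simp
    then have c: "0 \<le> cheb (- gram W s t) k" "0 \<le> cheb (- gram W s t) (Suc k)"
      using cheb_gram_nonneg[OF st(1) t(1) st(2)] by (simp_all add: less_imp_le Suc_leI del: cheb.simps)
    have "act w (simple_root s) = act v (act (?A k) (simple_root s))"
      using w v A st by (simp add: act_mult)
    also have "act (?A k) (simple_root s) = (\<lambda>r. cheb (- gram W s t) (Suc k) * simple_root ?x r
        + cheb (- gram W s t) k * simple_root ?y r)"
      using word_act_alternating[OF st(1) t(1), of k] act_value[OF alternating_in_lists] st t by simp
    also have "act v \<dots> = (\<lambda>r. cheb (- gram W s t) (Suc k) * act v (simple_root ?x) r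
        + cheb (- gram W s t) k * act v (simple_root ?y) r)"
      using v xy by (intro act_linear) auto
    finally show ?thesis
      using c x y by simp
  qed
qed

section \<open>Roots, reflections and inversion sets\<close>

lemma ascent_pos_root:
  assumes "w \<in> carrier W" "s \<in> S" "len (w \<otimes> s) = len w + 1"
  shows "act w (simple_root s) \<in> pos_roots W S"
  using ascent_nonneg[of w s] assms by (auto simp: pos_roots_def roots_def)

lemma act_simple_flip:
  assumes "w \<in> carrier W" "s \<in> S"
  shows "act (w \<otimes> s) (simple_root s) = (\<lambda>r. - act w (simple_root s) r)"
  using assms by (simp add: act_mult act_gen reflect_self act_uminus)

lemma descent_neg_root:
  assumes "w \<in> carrier W" "s \<in> S" "len (w \<otimes> s) + 1 = len w"
  shows "(\<lambda>r. - act w (simple_root s) r) \<in> pos_roots W S"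
  using ascent_pos_root[of "w \<otimes> s" s] act_simple_flip[of w s] assms by simp

lemma simple_pos_root: "s \<in> S \<Longrightarrow> simple_root s \<in> pos_roots W S"
  using len_gen_cases[of \<one> s] ascent_pos_root[of \<one> s] by auto

lemma rootE:
  assumes "\<beta> \<in> roots W S"
  obtains w s where "w \<in> carrier W" "s \<in> S" "\<beta> = act w (simple_root s)"
  using assms by (auto simp: roots_def)

lemma roots_root_space: "\<beta> \<in> roots W S \<Longrightarrow> \<beta> \<in> root_space S"
  by (metis rootE act_closed simple_root_space)

lemma pos_roots_roots: "\<beta> \<in> pos_roots W S \<Longrightarrow> \<beta> \<in> roots W S"
  by (simp add: pos_roots_def)

lemma act_roots: "w \<in> carrier W \<Longrightarrow> \<beta> \<in> roots W S \<Longrightarrow> act w \<beta> \<in> roots W S"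
  unfolding roots_def by clarsimp (metis act_mult m_closed simple_root_space)

lemma root_form_self: "\<beta> \<in> roots W S \<Longrightarrow> form \<beta> \<beta> = 1"
  by (elim rootE) (simp add: act_form)

lemma root_pos_or_neg:
  "\<beta> \<in> roots W S \<Longrightarrow> \<beta> \<in> pos_roots W S \<or> (\<lambda>r. - \<beta> r) \<in> pos_roots W S"
  by (elim rootE) (metis len_gen_cases ascent_pos_root descent_neg_root)

text \<open>Only the zero vector has both signs, and roots have norm 1.\<close>

lemma not_pos_and_neg:
  assumes "\<beta> \<in> pos_roots W S" "(\<lambda>r. - \<beta> r) \<in> pos_roots W S" shows False
proof -
  have "\<beta> s = 0" if "s \<in> S" for s
    using assms that unfolding pos_roots_def by force
  then have "form \<beta> \<beta> = 0"
    by (simp add: root_form_def)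
  then show False
    using root_form_self[OF pos_roots_roots[OF assms(1)]] by simp
qed

lemma neg_root_iff_descent:
  assumes "w \<in> carrier W" "s \<in> S"
  shows "(\<lambda>r. - act w (simple_root s) r) \<in> pos_roots W S \<longleftrightarrow> len (w \<otimes> s) + 1 = len w"
  using len_gen_cases[OF assms] ascent_pos_root[OF assms] descent_neg_root[OF assms]
    not_pos_and_neg[of "act w (simple_root s)"] by auto

text \<open>A nontrivial element has a descent s and so makes the simple root of s negative instead
  of fixing it.\<close>

lemma act_faithful:
  assumes "w \<in> carrier W" "\<And>v. v \<in> root_space S \<Longrightarrow> act w v = v"
  shows "w = \<one>"
proof (rule ccontr)
  assume "w \<noteq> \<one>"
  then obtain s where s: "s \<in> S" "len (w \<otimes> s) + 1 = len w"
    using descent_exists assms(1) by blast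
  then show False
    using descent_neg_root[of w s] simple_pos_root[of s] not_pos_and_neg[of "simple_root s"] assms
    by simp
qed

section \<open>Reflections attached to roots\<close>

lemma act_conjugate:
  assumes "w \<in> carrier W" "s \<in> S" "v \<in> root_space S"
  shows "act (w \<otimes> s \<otimes> inv w) v
    = (\<lambda>r. v r - 2 * form v (act w (simple_root s)) * act w (simple_root s) r)"
proof -
  let ?u = "act (inv w) v"
  have u: "?u \<in> root_space S" using assms act_closed by simp
  have wu: "act w ?u = v" using assms act_inv_cancel by simp
  have "act (w \<otimes> s \<otimes> inv w) v = act w (act s ?u)"
    using assms u by (simp add: act_mult)
  also have "act s ?u = (\<lambda>r. 1 * ?u r + (- 2 * form ?u (simple_root s)) * simple_root s r)"
    using act_gen[OF assms(2) u] unfolding reflect_eq .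
  also have "form ?u (simple_root s) = form v (act w (simple_root s))"
    using act_form[of w ?u "simple_root s"] assms u wu by simp
  finally show ?thesis
    unfolding act_linear[OF assms(1) u simple_root_space[OF assms(2)]] wu by simp
qed

text \<open>The action of \<open>w \<otimes> s \<otimes> inv w\<close> is a formula in the root
  alone, so two representations of \<beta> give elements that act equally; faithfulness makes them
  equal.\<close>

lemma root_reflection_eq:
  assumes "w \<in> carrier W" "s \<in> S" "\<beta> = act w (simple_root s)"
  shows "root_reflection W S \<beta> = w \<otimes> s \<otimes> inv w"
  unfolding root_reflection_def
proof (rule the_equality)
  show "\<exists>w'\<in>carrier W. \<exists>s'\<in>S. \<beta> = act w' (simple_root s') \<and> w \<otimes> s \<otimes> inv w = w' \<otimes> s' \<otimes> inv w'"
    using assms by blast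
  fix g assume "\<exists>w'\<in>carrier W. \<exists>s'\<in>S. \<beta> = act w' (simple_root s') \<and> g = w' \<otimes> s' \<otimes> inv w'"
  then obtain w' s' where g: "w' \<in> carrier W" "s' \<in> S" "\<beta> = act w' (simple_root s')"
      "g = w' \<otimes> s' \<otimes> inv w'"
    by blast
  let ?h = "w \<otimes> s \<otimes> inv w"
  have gh: "g \<in> carrier W" "?h \<in> carrier W"
    using assms g by auto
  have "inv g \<otimes> ?h = \<one>"
  proof (rule act_faithful)
    fix v assume v: "v \<in> root_space S"
    have "act ?h v = act g v"
      unfolding g(4) act_conjugate[OF assms(1,2) v] act_conjugate[OF g(1,2) v]
      using assms(3) g(3) by simp
    then show "act (inv g \<otimes> ?h) v = v"
      using gh v act_mult[of "inv g" ?h v] act_inv_cancel[of g v] by simp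
  qed (use gh in auto)
  then show "g = ?h"
    using gh by (metis inv_closed inv_equality inv_inv)
qed

lemma root_reflection_closed:
  "\<beta> \<in> roots W S \<Longrightarrow> root_reflection W S \<beta> \<in> carrier W"
  by (elim rootE) (simp add: root_reflection_eq)

lemma root_reflection_sq:
  assumes "\<beta> \<in> roots W S"
  shows "root_reflection W S \<beta> \<otimes> root_reflection W S \<beta> = \<one>"
proof -
  obtain w s where ws: "w \<in> carrier W" "s \<in> S" "\<beta> = act w (simple_root s)"
    using assms by (rule rootE)
  have "w \<otimes> s \<otimes> inv w \<otimes> (w \<otimes> s \<otimes> inv w) = w \<otimes> (s \<otimes> (inv w \<otimes> w) \<otimes> s) \<otimes> inv w"
    using ws by (simp only: m_assoc m_closed inv_closed gen_closed)
  then show ?thesis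
    using ws by (simp add: root_reflection_eq)
qed

lemma root_reflection_negates:
  assumes "\<beta> \<in> roots W S"
  shows "act (root_reflection W S \<beta>) \<beta> = (\<lambda>r. - \<beta> r)"
proof -
  obtain w s where ws: "w \<in> carrier W" "s \<in> S" "\<beta> = act w (simple_root s)"
    using assms by (rule rootE)
  then show ?thesis
    using act_conjugate[OF ws(1,2) roots_root_space[OF assms]] root_form_self[OF assms]
    by (simp add: root_reflection_eq)
qed

text \<open>The generator s changes only the coordinate at s. If \<gamma> became negative, its other
  coordinates would have to vanish, and norm 1 together with the sign would leave only the simple
  root of s.\<close>

lemma gen_permutes_pos_roots:
  assumes "s \<in> S" "\<gamma> \<in> pos_roots W S" "\<gamma> \<noteq> simple_root s"
  shows "act s \<gamma> \<in> pos_roots W S"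
proof (rule ccontr)
  assume "act s \<gamma> \<notin> pos_roots W S"
  have \<gamma>: "\<gamma> \<in> roots W S" "\<gamma> \<in> root_space S"
    using assms pos_roots_roots roots_root_space by auto
  then have neg: "(\<lambda>r. - act s \<gamma> r) \<in> pos_roots W S"
    using root_pos_or_neg act_roots assms(1) \<open>act s \<gamma> \<notin> pos_roots W S\<close> gen_closed by blast
  have "\<gamma> r = 0" if "r \<noteq> s" for r
  proof (cases "r \<in> S")
    case True
    then have "0 \<le> - act s \<gamma> r" "0 \<le> \<gamma> r"
      using neg assms(2) by (auto simp: pos_roots_def)
    moreover have "act s \<gamma> r = \<gamma> r"
      using act_gen[OF assms(1) \<gamma>(2)] that by (simp add: reflect_def simple_root_def)
    ultimately show ?thesis by simp
  qed (use \<gamma> in \<open>simp add: root_space_def\<close>)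
  then have eq: "\<gamma> = (\<lambda>r. \<gamma> s * simple_root s r + 0 * simple_root s r)"
    by (auto simp: simple_root_def)
  have "form \<gamma> \<gamma> = \<gamma> s * \<gamma> s"
    by (subst (1 2) eq) (use assms(1) in \<open>simp only: form_linear_left form_linear_right, simp\<close>)
  then have "\<gamma> s * \<gamma> s = 1"
    using root_form_self[OF \<gamma>(1)] by simp
  moreover have "0 \<le> \<gamma> s"
    using assms by (simp add: pos_roots_def)
  ultimately have "\<gamma> s = 1"
    by (simp add: square_eq_1_iff)
  then show False
    using eq assms(3) by simp
qed

section \<open>Inversion sets and length\<close>

abbreviation inversions :: "'a \<Rightarrow> ('a \<Rightarrow> real) set" where
  "inversions \<equiv> inversion_set W S"

lemma inversions_one [simp]: "inversions \<one> = {}"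
  using not_pos_and_neg pos_roots_roots roots_root_space by (fastforce simp: inversion_set_def)

lemma inversions_pos: "\<beta> \<in> inversions w \<Longrightarrow> \<beta> \<in> pos_roots W S"
  by (simp add: inversion_set_def)

text \<open>Passing from \<open>v\<close> to \<open>v \<otimes> s\<close> applies s once more after
  \<open>inv v\<close>, and s changes the sign of its own simple root and of its negative only. The
  first case is the new root; the second would make the positive root
  \<open>act v (simple_root s)\<close> the negative of a positive root.\<close>

lemma inversions_step:
  assumes v: "v \<in> carrier W" and s: "s \<in> S" and l: "len (v \<otimes> s) = len v + 1"
  shows "inversions (v \<otimes> s) = insert (act v (simple_root s)) (inversions v)"
    and "act v (simple_root s) \<notin> inversions v"
proof -
  let ?b = "act v (simple_root s)"
  have b: "?b \<in> pos_roots W S" using ascent_pos_root assms by blast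
  show "?b \<notin> inversions v"
    using act_inv_cancel(1)[OF v simple_root_space[OF s]] not_pos_and_neg[OF simple_pos_root[OF s]]
    by (auto simp: inversion_set_def)
  have "\<alpha> \<in> inversions (v \<otimes> s) \<longleftrightarrow> \<alpha> = ?b \<or> \<alpha> \<in> inversions v" if \<alpha>: "\<alpha> \<in> pos_roots W S" for \<alpha>
  proof -
    let ?g = "act (inv v) \<alpha>"
    have \<alpha>r: "\<alpha> \<in> roots W S" "\<alpha> \<in> root_space S"
      using \<alpha> pos_roots_roots roots_root_space by auto
    have g: "?g \<in> roots W S" "?g \<in> root_space S"
      using \<alpha>r v act_roots roots_root_space by auto
    have \<alpha>g: "\<alpha> = act v ?g"
      using act_inv_cancel v \<alpha>r by simp
    have "inv (v \<otimes> s) = s \<otimes> inv v"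
      using v s by (simp add: inv_mult_group)
    then have in_vs: "\<alpha> \<in> inversions (v \<otimes> s) \<longleftrightarrow> (\<lambda>r. - act s ?g r) \<in> pos_roots W S"
      using \<alpha> \<alpha>r v s by (simp add: inversion_set_def act_mult)
    have in_v: "\<alpha> \<in> inversions v \<longleftrightarrow> (\<lambda>r. - ?g r) \<in> pos_roots W S"
      using \<alpha> by (simp add: inversion_set_def)
    show ?thesis
    proof
      assume neg: "\<alpha> \<in> inversions (v \<otimes> s)"
      show "\<alpha> = ?b \<or> \<alpha> \<in> inversions v"
      proof (cases "?g \<in> pos_roots W S")
        case True
        then have "?g = simple_root s"
          using gen_permutes_pos_roots[OF s True] neg in_vs not_pos_and_neg by blast
        then show ?thesis using \<alpha>g by simp
      next
        case False
        then show ?thesis using in_v root_pos_or_neg g by blast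
      qed
    next
      assume "\<alpha> = ?b \<or> \<alpha> \<in> inversions v"
      then show "\<alpha> \<in> inversions (v \<otimes> s)"
      proof
        assume "\<alpha> = ?b"
        then have "?g = simple_root s"
          using act_inv_cancel v s by simp
        then show ?thesis
          using in_vs s simple_pos_root by (simp add: act_gen reflect_self)
      next
        assume "\<alpha> \<in> inversions v"
        then have neg: "(\<lambda>r. - ?g r) \<in> pos_roots W S" using in_v by simp
        have "(\<lambda>r. - ?g r) \<noteq> simple_root s"
        proof
          assume "(\<lambda>r. - ?g r) = simple_root s"
          then have "?b = (\<lambda>r. - \<alpha> r)"
            using act_uminus[OF v g(2)] \<alpha>g by simp
          then show False
            using b \<alpha> not_pos_and_neg by simp
        qed
        then have "act s (\<lambda>r. - ?g r) \<in> pos_roots W S"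
          using gen_permutes_pos_roots s neg by blast
        then show ?thesis
          using in_vs act_uminus[of s ?g] s g by simp
      qed
    qed
  qed
  then show "inversions (v \<otimes> s) = insert ?b (inversions v)"
    using b inversions_pos by blast
qed

lemma finite_inversions: "w \<in> carrier W \<Longrightarrow> finite (inversions w)"
  by (induction w rule: ascent_induct) (simp_all add: inversions_step)

text \<open>Appending an ascent s to v adds the root \<open>?b\<close>. It is an inversion of x
  exactly when s is a descent of \<open>inv x \<otimes> v\<close>. Then the length drops by 1 while
  twice the cardinality grows by 2; otherwise the length grows by 1. Either way both sides grow by
  1.\<close>

lemma len_inv_mult:
  assumes x: "x \<in> carrier W" and "y \<in> carrier W"
  shows "len (inv x \<otimes> y) + 2 * card (inversions x \<inter> inversions y) = len x + len y"
  using assms(2)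
proof (induction y rule: ascent_induct)
  case one
  then show ?case using x by simp
next
  case (step v s)
  let ?b = "act v (simple_root s)"
  have xv: "inv x \<otimes> v \<in> carrier W" using x step by simp
  have b: "?b \<in> pos_roots W S" using ascent_pos_root step by blast
  have assoc: "inv x \<otimes> (v \<otimes> s) = inv x \<otimes> v \<otimes> s"
    using x step by (simp add: m_assoc)
  have "act (inv x \<otimes> v) (simple_root s) = act (inv x) ?b"
    using x step by (simp add: act_mult)
  then have iff: "?b \<in> inversions x \<longleftrightarrow> len (inv x \<otimes> v \<otimes> s) + 1 = len (inv x \<otimes> v)"
    using neg_root_iff_descent[OF xv step(2)] b by (simp add: inversion_set_def)
  have fin: "finite (inversions x \<inter> inversions v)"
    using finite_inversions x by blast
  have notin: "?b \<notin> inversions x \<inter> inversions v"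
    using inversions_step(2)[OF step(1-3)] by simp
  show ?case
  proof (cases "?b \<in> inversions x")
    case True
    then have "inversions x \<inter> inversions (v \<otimes> s) = insert ?b (inversions x \<inter> inversions v)"
      using inversions_step(1)[OF step(1-3)] by auto
    then show ?thesis
      using iff True fin notin step assoc by simp
  next
    case False
    then have "inversions x \<inter> inversions (v \<otimes> s) = inversions x \<inter> inversions v"
      using inversions_step(1)[OF step(1-3)] by auto
    moreover have "len (inv x \<otimes> v \<otimes> s) = len (inv x \<otimes> v) + 1"
      using len_gen_cases[OF xv step(2)] iff False by blast
    ultimately show ?thesis
      using step assoc by simp
  qed
qed

lemma cone_type_inv:
  assumes "x \<in> carrier W"
  shows "cone_type W S (inv x) = {y \<in> carrier W. inversions x \<inter> inversions y = {}}"
proof -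
  have "len (inv x \<otimes> y) = len (inv x) + len y \<longleftrightarrow> inversions x \<inter> inversions y = {}"
    if "y \<in> carrier W" for y
  proof -
    \<comment> \<open>An infinite set would also have \<open>card\<close> 0, so finiteness is what
      turns a zero count into disjointness.\<close>
    have "finite (inversions x \<inter> inversions y)"
      using finite_inversions assms by blast
    from card_0_eq[OF this] show ?thesis
      using len_inv_mult[OF assms that] len_inv[OF assms] by linarith
  qed
  then show ?thesis
    unfolding cone_type_def by blast
qed

text \<open>Strong exchange along a reduced word: if \<beta> is the root added by the last letter,
  its reflection deletes that letter; otherwise it already shortens the prefix, and the last letter
  adds at most 1 on the left-hand side.\<close>

lemma reflection_shortens:
  assumes "w \<in> carrier W" "\<beta> \<in> inversions w"
  shows "len (root_reflection W S \<beta> \<otimes> w) < len w"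
  using assms
proof (induction w rule: ascent_induct)
  case (step v s)
  let ?t = "root_reflection W S \<beta>"
  have t: "?t \<in> carrier W"
    using step.prems inversions_pos pos_roots_roots root_reflection_closed by blast
  show ?case
  proof (cases "\<beta> \<in> inversions v")
    case True
    then have "len (?t \<otimes> v) < len v" by (rule step.IH)
    moreover have "len (?t \<otimes> v \<otimes> s) \<le> len (?t \<otimes> v) + 1"
      using len_gen_cases[of "?t \<otimes> v" s] step t by auto
    ultimately show ?thesis
      using step t by (simp add: m_assoc)
  next
    case False
    then have "\<beta> = act v (simple_root s)"
      using inversions_step(1)[OF step(1-3)] step.prems by simp
    then have "?t \<otimes> (v \<otimes> s) = v \<otimes> s \<otimes> (inv v \<otimes> v) \<otimes> s"
      using root_reflection_eq[OF step(1,2)] step(1,2)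
      by (simp only: m_assoc m_closed inv_closed gen_closed)
    then show ?thesis
      using step by simp
  qed
qed simp

text \<open>If \<beta> is not an inversion of w, it is one of \<open>?t \<otimes> w\<close>, because
  \<open>?t\<close> negates \<beta>. Shortening \<open>?t \<otimes> w\<close> by \<open>?t\<close>
  gives back w, so one direction of the exchange argument yields the other.\<close>

lemma pos_halfspace_eq:
  assumes "\<beta> \<in> pos_roots W S"
  shows "pos_halfspace W S \<beta> = {w \<in> carrier W. \<beta> \<notin> inversions w}"
proof -
  let ?t = "root_reflection W S \<beta>"
  have \<beta>: "\<beta> \<in> roots W S" "\<beta> \<in> root_space S"
    using assms pos_roots_roots roots_root_space by auto
  have t: "?t \<in> carrier W" "?t \<otimes> ?t = \<one>"
    using \<beta> root_reflection_closed root_reflection_sq by auto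
  have "len w < len (?t \<otimes> w)" if w: "w \<in> carrier W" "\<beta> \<notin> inversions w" for w
  proof -
    have "act (inv w) \<beta> \<in> pos_roots W S"
      using w assms root_pos_or_neg[OF act_roots[OF _ \<beta>(1), of "inv w"]]
      by (auto simp: inversion_set_def)
    moreover have "inv (?t \<otimes> w) = inv w \<otimes> ?t"
      using t w by (simp add: inv_mult_group inv_equality)
    then have "act (inv (?t \<otimes> w)) \<beta> = (\<lambda>r. - act (inv w) \<beta> r)"
      using t w \<beta> by (simp add: act_mult root_reflection_negates act_uminus)
    ultimately have "\<beta> \<in> inversions (?t \<otimes> w)"
      using assms by (simp add: inversion_set_def)
    then have "len (?t \<otimes> (?t \<otimes> w)) < len (?t \<otimes> w)"
      using reflection_shortens[of "?t \<otimes> w" \<beta>] t w by simp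
    then show ?thesis
      using t w by (simp flip: m_assoc)
  qed
  then show ?thesis
    using reflection_shortens by (fastforce simp: pos_halfspace_def)
qed

section \<open>Boundary roots\<close>

definition boundary :: "'a \<Rightarrow> ('a \<Rightarrow> real) set" where
  "boundary x = {\<beta> \<in> pos_roots W S. \<exists>w \<in> carrier W. inversions x \<inter> inversions w = {\<beta>}}"

text \<open>The prefix v misses A, so a meeting after the next letter can only come from the one
  root that this letter adds. The arbitrary A lets the same argument serve the half-space
  representation and the comparison of two elements with equal cone types.\<close>

lemma first_inversion:
  assumes "w \<in> carrier W" "A \<inter> inversions w \<noteq> {}"
  obtains v s where "v \<in> carrier W" "s \<in> S" "A \<inter> inversions v = {}"
    "A \<inter> inversions (v \<otimes> s) = {act v (simple_root s)}"
    "inversions (v \<otimes> s) = insert (act v (simple_root s)) (inversions v)"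
    "inversions (v \<otimes> s) \<subseteq> inversions w"
  using assms
proof (induction w arbitrary: thesis rule: ascent_induct)
  case (step v s)
  note ins = inversions_step(1)[OF step(1-3)]
  show ?case
  proof (cases "A \<inter> inversions v = {}")
    case True
    then have "A \<inter> inversions (v \<otimes> s) = {act v (simple_root s)}"
      using ins step.prems(2) by auto
    then show ?thesis
      using step.prems(1)[of v s] step(1,2) True ins by blast
  next
    case False
    show ?thesis
      by (rule step.IH[OF _ False], rule step.prems(1)) (use ins in auto)
  qed
qed simp

text \<open>Take the shortest prefix of a reduced word of w whose inversions meet those of y. By
  \<open>same\<close> it also meets those of x, while the prefix before it misses both, so the added
  root is common to x and w and hence equals \<beta>. The prefix then witnesses \<beta> for
  y.\<close>

lemma boundary_mono:
  assumes x: "x \<in> carrier W" and y: "y \<in> carrier W"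
    and eq: "cone_type W S (inv x) = cone_type W S (inv y)"
  shows "boundary x \<subseteq> boundary y"
proof
  fix \<beta> assume "\<beta> \<in> boundary x"
  then obtain w where \<beta>: "\<beta> \<in> pos_roots W S" and w: "w \<in> carrier W"
    and xw: "inversions x \<inter> inversions w = {\<beta>}"
    by (auto simp: boundary_def)
  have same: "inversions x \<inter> inversions u = {} \<longleftrightarrow> inversions y \<inter> inversions u = {}"
    if "u \<in> carrier W" for u
    using eq that unfolding cone_type_inv[OF x] cone_type_inv[OF y] by blast
  have "inversions y \<inter> inversions w \<noteq> {}"
    using same[OF w] xw by simp
  from w this obtain v s where v: "v \<in> carrier W" "s \<in> S" "inversions y \<inter> inversions v = {}"
      "inversions y \<inter> inversions (v \<otimes> s) = {act v (simple_root s)}"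
      "inversions (v \<otimes> s) = insert (act v (simple_root s)) (inversions v)"
      "inversions (v \<otimes> s) \<subseteq> inversions w"
    by (rule first_inversion)
  have xv: "inversions x \<inter> inversions v = {}"
    using same[OF v(1)] v(3) by simp
  have "inversions x \<inter> inversions (v \<otimes> s) \<noteq> {}"
    using same[of "v \<otimes> s"] v(1,2,4) by simp
  then obtain \<gamma> where \<gamma>: "\<gamma> \<in> inversions x" "\<gamma> \<in> inversions (v \<otimes> s)"
    by auto
  have "\<gamma> = act v (simple_root s)"
    using \<gamma> xv v(5) by auto
  moreover have "\<gamma> \<in> inversions x \<inter> inversions w"
    using \<gamma> v(6) by auto
  ultimately have "act v (simple_root s) = \<beta>"
    using xw by simp
  then show "\<beta> \<in> boundary y"
    unfolding boundary_def using \<beta> v by (auto intro!: bexI[of _ "v \<otimes> s"])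
qed

lemma boundary_roots_eq:
  assumes x: "x \<in> carrier W" and T: "T = cone_type W S (inv x)"
  shows "boundary_roots W S T = boundary x"
  unfolding boundary_roots_def boundary_def[symmetric]
proof (rule the_equality)
  show "\<forall>y\<in>carrier W. T = cone_type W S (inv y) \<longrightarrow> boundary x = boundary y"
    using boundary_mono x T by blast
qed (use assms in blast)

text \<open>Intersecting with \<open>carrier W\<close> encodes the convention for the empty index
  set, where \<open>\<Inter>\<close> alone would be the whole type.\<close>

lemma halfspace_representation:
  assumes x: "x \<in> carrier W" and T: "T = cone_type W S (inv x)"
  shows "T = carrier W \<inter> (\<Inter>\<beta> \<in> boundary x. pos_halfspace W S \<beta>)"
proof -
  have half: "pos_halfspace W S \<beta> = {w \<in> carrier W. \<beta> \<notin> inversions w}" if "\<beta> \<in> boundary x" for \<beta>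
    using that by (simp add: boundary_def pos_halfspace_eq)
  have "(\<forall>\<beta> \<in> boundary x. \<beta> \<notin> inversions w) \<longleftrightarrow> inversions x \<inter> inversions w = {}"
    if w: "w \<in> carrier W" for w
  proof
    assume avoid: "\<forall>\<beta> \<in> boundary x. \<beta> \<notin> inversions w"
    show "inversions x \<inter> inversions w = {}"
    proof (rule ccontr)
      assume "inversions x \<inter> inversions w \<noteq> {}"
      with w obtain v s where v: "v \<in> carrier W" "s \<in> S" "inversions x \<inter> inversions v = {}"
          "inversions x \<inter> inversions (v \<otimes> s) = {act v (simple_root s)}"
          "inversions (v \<otimes> s) = insert (act v (simple_root s)) (inversions v)"
          "inversions (v \<otimes> s) \<subseteq> inversions w"
        by (rule first_inversion)
      then have b: "act v (simple_root s) \<in> inversions (v \<otimes> s)"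
        by simp
      then have "act v (simple_root s) \<in> boundary x"
        unfolding boundary_def using inversions_pos v(1,2,4) gen_closed by blast
      then show False
        using avoid b v(6) by blast
    qed
  qed (auto simp: boundary_def)
  then show ?thesis
    unfolding T cone_type_inv[OF x] using half by auto
qed

lemma halfspace_irredundant:
  assumes x: "x \<in> carrier W" and T: "T = cone_type W S (inv x)" and \<beta>\<^sub>0: "\<beta>\<^sub>0 \<in> boundary x"
  shows "T \<subset> carrier W \<inter> (\<Inter>\<beta> \<in> boundary x - {\<beta>\<^sub>0}. pos_halfspace W S \<beta>)"
proof -
  obtain w where w: "w \<in> carrier W" "inversions x \<inter> inversions w = {\<beta>\<^sub>0}"
    using \<beta>\<^sub>0 by (auto simp: boundary_def)
  have "w \<in> pos_halfspace W S \<beta>" if "\<beta> \<in> boundary x - {\<beta>\<^sub>0}" for \<beta>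
  proof -
    \<comment> \<open>Boundary roots are inversions of x, and w shares only the removed root with x,
      so w inverts none of the others.\<close>
    have "\<beta> \<in> inversions x" "\<beta> \<in> pos_roots W S"
      using that by (auto simp: boundary_def)
    then show ?thesis
      using that w by (auto simp: pos_halfspace_eq)
  qed
  moreover have "w \<notin> T"
    using w by (simp add: T cone_type_inv[OF x])
  moreover have "T \<subseteq> carrier W \<inter> (\<Inter>\<beta> \<in> boundary x - {\<beta>\<^sub>0}. pos_halfspace W S \<beta>)"
    using halfspace_representation[OF x T] by blast
  ultimately show ?thesis
    using w(1) by blast
qed

end

theorem theorem7:
  fixes W :: "('a, 'b) monoid_scheme" and S :: "'a set" and T :: "'a set"
  assumes "coxeter_system W S" and "finite S" and "is_cone_type W S T"
  shows "T = carrier W \<inter> (\<Inter>\<beta> \<in> boundary_roots W S T. pos_halfspace W S \<beta>) \<and>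
    (\<forall>\<beta>\<^sub>0 \<in> boundary_roots W S T.
       T \<subset> carrier W \<inter> (\<Inter>\<beta> \<in> boundary_roots W S T - {\<beta>\<^sub>0}. pos_halfspace W S \<beta>))"
proof -
  interpret coxeter W S
    using assms(1,2) unfolding coxeter_def coxeter_axioms_def coxeter_system_def by blast
  obtain z where z: "z \<in> carrier W" "T = cone_type W S z"
    using assms(3) by (auto simp: is_cone_type_def)
  define x where "x = inv\<^bsub>W\<^esub> z"
  have x: "x \<in> carrier W" "T = cone_type W S (inv\<^bsub>W\<^esub> x)"
    using z by (simp_all add: x_def)
  show ?thesis
    unfolding boundary_roots_eq[OF x]
    using halfspace_representation[OF x] halfspace_irredundant[OF x] by blast
qed

end
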